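(* Every pair of orthogonal quantum Latin squares of order $5$ is classical.
   Context: A quantum Latin square (QLS) of order $n$ is an $n\times n$ matrix $\Psi=(\psi_{ij})_{1\le i,j\le n}$ whose entries are unit vectors in $\mathbb C^n$ such that the entries of each row and the entries of each column form an orthonormal basis of $\mathbb C^n$. Two QLS $\Psi=(\psi_{ij})$ and $\Phi=(\phi_{ij})$ of order $n$ are orthogonal if $\{\psi_{ij}\otimes\phi_{ij}: 1\le i,j\le n\}$ is an orthonormal basis of $\mathbb C^n\otimes\mathbb C^n$. Fix the standard orthonormal basis $\ket{1},\dots,\ket{n}$ of $\mathbb C^n$. Two pairs of orthogonal QLS of order $n$ are isotopic if one can be obtained from the other by a sequence of the operations: (i) multiplying individual entries by phase factors; (ii) permuting the rows, and permuting the columns, simultaneously in both squares; (iii) for each square separately, applying one unitary transformation of $\mathbb C^n$ to all entries of that square. A pair is classical if it is isotopic to a pair all of whose entries lie in $\{\ket{1},\dots,\ket{n}\}$. *)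

theory Defs
  imports Complex_Main "HOL-Combinatorics.Permutations"
begin

text \<open>Vectors of a finite-dimensional complex coordinate space with coordinate
index set I are functions 'i => complex vanishing outside I.
C^n has index set {..<n} (the standard basis |1>,...,|n> is e 0,...,e (n-1));
C^n (x) C^n has index set {..<n} x {..<n}.\<close>

definition cvecs :: "'i set \<Rightarrow> ('i \<Rightarrow> complex) set" where
  "cvecs I = {v. \<forall>x. x \<notin> I \<longrightarrow> v x = 0}"

definition cinner :: "'i set \<Rightarrow> ('i \<Rightarrow> complex) \<Rightarrow> ('i \<Rightarrow> complex) \<Rightarrow> complex" where
  "cinner I u v = (\<Sum>x\<in>I. cnj (u x) * v x)"

definition is_onb :: "'i set \<Rightarrow> ('j \<Rightarrow> 'i \<Rightarrow> complex) \<Rightarrow> 'j set \<Rightarrow> bool" where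
  "is_onb I F J \<longleftrightarrow>
     (\<forall>j\<in>J. F j \<in> cvecs I) \<and>
     (\<forall>j\<in>J. \<forall>k\<in>J. cinner I (F j) (F k) = (if j = k then 1 else 0)) \<and>
     (\<forall>v\<in>cvecs I. \<exists>c. v = (\<lambda>x. \<Sum>j\<in>J. c j * F j x))"

definition tensor :: "(nat \<Rightarrow> complex) \<Rightarrow> (nat \<Rightarrow> complex) \<Rightarrow> (nat \<times> nat \<Rightarrow> complex)" where
  "tensor u v = (\<lambda>(a, b). u a * v b)"

text \<open>A square of order n: entry (i,j), for i,j < n, is Psi i j.\<close>
type_synonym square = "nat \<Rightarrow> nat \<Rightarrow> nat \<Rightarrow> complex"

definition is_QLS :: "nat \<Rightarrow> square \<Rightarrow> bool" where
  "is_QLS n Psi \<longleftrightarrow>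
     (\<forall>i<n. is_onb {..<n} (\<lambda>j. Psi i j) {..<n}) \<and>
     (\<forall>j<n. is_onb {..<n} (\<lambda>i. Psi i j) {..<n})"

definition orthogonal_QLS :: "nat \<Rightarrow> square \<Rightarrow> square \<Rightarrow> bool" where
  "orthogonal_QLS n Psi Phi \<longleftrightarrow>
     is_onb ({..<n} \<times> {..<n}) (\<lambda>(i, j). tensor (Psi i j) (Phi i j)) ({..<n} \<times> {..<n})"

definition unitary_mat :: "nat \<Rightarrow> (nat \<Rightarrow> nat \<Rightarrow> complex) \<Rightarrow> bool" where
  "unitary_mat n U \<longleftrightarrow>
     (\<forall>a<n. \<forall>b<n. (\<Sum>k<n. cnj (U k a) * U k b) = (if a = b then 1 else 0))"

definition apply_mat :: "nat \<Rightarrow> (nat \<Rightarrow> nat \<Rightarrow> complex) \<Rightarrow> (nat \<Rightarrow> complex) \<Rightarrow> (nat \<Rightarrow> complex)" where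
  "apply_mat n U v = (\<lambda>a. if a < n then (\<Sum>b<n. U a b * v b) else 0)"

inductive isotopy_step :: "nat \<Rightarrow> square \<times> square \<Rightarrow> square \<times> square \<Rightarrow> bool" for n where
  phase: "\<lbrakk>\<forall>i<n. \<forall>j<n. norm (c i j) = 1 \<and> norm (d i j) = 1;
           \<forall>i<n. \<forall>j<n. Psi' i j = (\<lambda>a. c i j * Psi i j a) \<and> Phi' i j = (\<lambda>a. d i j * Phi i j a)\<rbrakk>
          \<Longrightarrow> isotopy_step n (Psi, Phi) (Psi', Phi')"
| perm: "\<lbrakk>\<sigma> permutes {..<n}; \<tau> permutes {..<n};
           \<forall>i<n. \<forall>j<n. Psi' i j = Psi (\<sigma> i) (\<tau> j) \<and> Phi' i j = Phi (\<sigma> i) (\<tau> j)\<rbrakk>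
          \<Longrightarrow> isotopy_step n (Psi, Phi) (Psi', Phi')"
| unitary: "\<lbrakk>unitary_mat n U; unitary_mat n V;
           \<forall>i<n. \<forall>j<n. Psi' i j = apply_mat n U (Psi i j) \<and> Phi' i j = apply_mat n V (Phi i j)\<rbrakk>
          \<Longrightarrow> isotopy_step n (Psi, Phi) (Psi', Phi')"

definition isotopic :: "nat \<Rightarrow> square \<times> square \<Rightarrow> square \<times> square \<Rightarrow> bool" where
  "isotopic n = (isotopy_step n)\<^sup>*\<^sup>*"

definition std_basis :: "nat \<Rightarrow> nat \<Rightarrow> complex" where
  "std_basis k = (\<lambda>a. if a = k then 1 else 0)"

definition classical_pair :: "nat \<Rightarrow> square \<Rightarrow> square \<Rightarrow> bool" where
  "classical_pair n Psi Phi \<longleftrightarrow>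
     (\<exists>Psi' Phi'. isotopic n (Psi, Phi) (Psi', Phi') \<and>
        (\<forall>i<n. \<forall>j<n. Psi' i j \<in> std_basis ` {..<n} \<and> Phi' i j \<in> std_basis ` {..<n}))"

end

theory Submission
  imports Defs
begin

text \<open>
  Orthogonality of the pair means that two distinct cells are orthogonal in the first or in the
  second square. So for two rows the two transition matrices are unitary with zero diagonal
  and disjoint supports; comparing zero patterns, no vector has three nonzero coefficients in a row
  or, by transposition, in a column of its own square.

  Suppose two vectors x, y of the first square are neither orthogonal nor parallel. Then every row
  and every column has exactly two entries in the plane P of x and y, the others being orthogonal
  to P. The entries in P that are parallel or orthogonal to x and the remaining ones occupy
  complementary rows and columns, so they form a 2x2 block and six cells of the opposite 3x3 block.
  Entries of different blocks are not orthogonal, so their counterparts in the second square are.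
  For each of the two cells of a row of the 2x2 block this leaves the squared moduli
  of the inner products with the three other cells of the 3x3 block, with sum at least 2. But
  by Bessel the two sums add up to at most 3, a contradiction. So the vectors of
  each square are pairwise orthogonal or parallel, and mapping the first row to the standard basis
  makes the square classical.
\<close>

section \<open>Zero patterns of two disjoint unitary matrices\<close>

text \<open>\<open>u\<close> and \<open>v\<close> model the squared moduli of two unitary matrices;
  \<open>quad\<close> reflects that two orthogonal vectors cannot have exactly one common nonzero
  coordinate. If row \<open>a\<close> of \<open>u\<close> met \<open>b\<close> or \<open>c\<close>,
  row \<open>m\<close> of \<open>u\<close> would be forced to be nonzero at \<open>a\<close>,
  \<open>b\<close> and \<open>c\<close>, and row \<open>m\<close> of \<open>v\<close> would
  vanish.\<close>

lemma unitary_pattern_aux: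
  fixes u v :: "nat \<Rightarrow> nat \<Rightarrow> real"
  assumes I: "{..<5} = {j, m, a, b, c}" and dist: "distinct [j, m, a, b, c]"
    and nonneg: "\<And>r l. 0 \<le> u r l" "\<And>r l. 0 \<le> v r l"
    and rows: "\<And>r. r < 5 \<Longrightarrow> (\<Sum>l<5. u r l) = 1" "\<And>r. r < 5 \<Longrightarrow> (\<Sum>l<5. v r l) = 1"
    and cols: "\<And>l. l < 5 \<Longrightarrow> (\<Sum>r<5. u r l) = 1" "\<And>l. l < 5 \<Longrightarrow> (\<Sum>r<5. v r l) = 1"
    and diag: "\<And>r. r < 5 \<Longrightarrow> u r r = 0" "\<And>r. r < 5 \<Longrightarrow> v r r = 0"
    and disj: "\<And>r l. r < 5 \<Longrightarrow> l < 5 \<Longrightarrow> u r l = 0 \<or> v r l = 0"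
    and quad: "\<And>r s l. \<lbrakk>r < 5; s < 5; r \<noteq> s; l < 5; u r l \<noteq> 0; u s l \<noteq> 0\<rbrakk>
                 \<Longrightarrow> \<exists>l'<5. l' \<noteq> l \<and> u r l' \<noteq> 0 \<and> u s l' \<noteq> 0"
    and nz: "u j a \<noteq> 0" "u j b \<noteq> 0" "u j c \<noteq> 0"
  shows "u a b = 0 \<and> u a c = 0"
proof (rule ccontr)
  assume contra: "\<not> (u a b = 0 \<and> u a c = 0)"
  have lt: "j < 5" "m < 5" "a < 5" "b < 5" "c < 5"
    unfolding lessThan_iff[symmetric] I by auto
  have sum5: "(\<Sum>l<5. f l) = f j + f m + f a + f b + f c" for f :: "nat \<Rightarrow> real"
    unfolding I using dist by (simp add: add.assoc)
  note ru = rows(1)[unfolded sum5] and rv = rows(2)[unfolded sum5]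
  note cu = cols(1)[unfolded sum5] and cv = cols(2)[unfolded sum5]
  have ex: "\<exists>l'\<in>{j, m, a, b, c}. l' \<noteq> l \<and> u r l' \<noteq> 0 \<and> u s l' \<noteq> 0"
    if "r < 5" "s < 5" "r \<noteq> s" "l < 5" "u r l \<noteq> 0" "u s l \<noteq> 0" for r s l
    using quad[OF that] unfolding I[symmetric] by blast
  \<comment> \<open>Row \<open>j\<close> of \<open>u\<close> occupies \<open>a\<close>,
    \<open>b\<close>, \<open>c\<close>, so the whole mass of row \<open>j\<close> of
    \<open>v\<close> sits at \<open>m\<close>, which empties the rest of column \<open>m\<close> of
    \<open>v\<close>.\<close>
  have "v j a = 0" "v j b = 0" "v j c = 0"
    using disj lt nz by metis+
  then have vjm: "v j m = 1"
    using rv[of j] diag(2)[of j] lt by simp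
  then have ujm: "u j m = 0"
    using disj[of j m] lt by simp
  have vm: "v m m = 0" "v a m = 0" "v b m = 0" "v c m = 0"
    using cv[of m] vjm lt nonneg(2)[of m m] nonneg(2)[of a m] nonneg(2)[of b m] nonneg(2)[of c m]
    by linarith+
  have dg: "u j j = 0" "u m m = 0" "u a a = 0" "u b b = 0" "u c c = 0"
    "v j j = 0" "v a a = 0" "v b b = 0" "v c c = 0"
    using diag lt by auto
  \<comment> \<open>Rows \<open>a\<close> and \<open>j\<close> of \<open>u\<close> overlap at
    \<open>b\<close> or \<open>c\<close>; \<open>quad\<close> demands a second overlap, and only the
    other of these two columns is available.\<close>
  have uab: "u a b \<noteq> 0" "u a c \<noteq> 0"
    using contra ex[of a j b] ex[of a j c] lt dist nz ujm dg by auto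
  then have "v a b = 0" "v a c = 0"
    using disj lt by metis+
  then have vaj: "v a j = 1"
    using rv[of a] lt vm dg by simp
  have vj: "v m j = 0" "v b j = 0" "v c j = 0"
    using cv[of j] vaj lt nonneg(2)[of m j] nonneg(2)[of j j] nonneg(2)[of b j] nonneg(2)[of c j]
    by linarith+
  \<comment> \<open>Row \<open>b\<close> of \<open>v\<close> has mass 1 and only \<open>a\<close>
    and \<open>c\<close> are left for it, so \<open>u\<close> misses one of them in row
    \<open>b\<close>; \<open>quad\<close> against row \<open>j\<close> then removes the
    other.\<close>
  have "u b a = 0 \<or> u b c = 0"
    using rv[of b] disj[of b a] disj[of b c] lt vj vm dg by auto
  then have ub: "u b a = 0" "u b c = 0"
    using ex[of b j a] ex[of b j c] lt dist nz ujm dg by auto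
  have "u c a = 0 \<or> u c b = 0"
    using rv[of c] disj[of c a] disj[of c b] lt vj vm dg by auto
  then have uc: "u c a = 0" "u c b = 0"
    using ex[of c j a] ex[of c j b] lt dist nz ujm dg by auto
  \<comment> \<open>Rows \<open>b\<close> and \<open>c\<close> of \<open>u\<close> live in columns
    \<open>j\<close> and \<open>m\<close> and exhaust the total mass 2 of these columns.\<close>
  have umj: "u m j = 0"
    using ru[of b] ru[of c] cu[of j] cu[of m] lt ub uc dg ujm nonneg(1)[of m j] nonneg(1)[of a j]
      nonneg(1)[of a m] by linarith
  \<comment> \<open>\<open>u j a\<close> is less than 1, since row \<open>j\<close> has other
    positive entries; the rest of column \<open>a\<close> can only lie in row
    \<open>m\<close>.\<close>
  have "u m a \<noteq> 0"
    using cu[of a] ru[of j] lt ub uc dg nz ujm nonneg(1)[of j b] nonneg(1)[of j c] by auto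
  then have "u m b \<noteq> 0 \<or> u m c \<noteq> 0"
    using ex[of m j a] lt dist nz dg umj by auto
  moreover have "u m c \<noteq> 0" if "u m b \<noteq> 0"
    using ex[of m a b] that lt dist dg umj uab by auto
  moreover have "u m b \<noteq> 0" if "u m c \<noteq> 0"
    using ex[of m a c] that lt dist dg umj uab by auto
  ultimately have "u m b \<noteq> 0" "u m c \<noteq> 0"
    by blast+
  then show False
    using rv[of m] disj[of m a] disj[of m b] disj[of m c] \<open>u m a \<noteq> 0\<close> lt vm vj by auto
qed

text \<open>By three uses of \<open>unitary_pattern_aux\<close>, rows \<open>a\<close>,
  \<open>b\<close>, \<open>c\<close> of \<open>u\<close> are confined to columns \<open>j\<close>
  and \<open>m\<close>: mass 3 in two columns of mass 1.\<close>

lemma unitary_pattern_row_le_2: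
  fixes u v :: "nat \<Rightarrow> nat \<Rightarrow> real"
  assumes nonneg: "\<And>r l. 0 \<le> u r l" "\<And>r l. 0 \<le> v r l"
    and rows: "\<And>r. r < 5 \<Longrightarrow> (\<Sum>l<5. u r l) = 1" "\<And>r. r < 5 \<Longrightarrow> (\<Sum>l<5. v r l) = 1"
    and cols: "\<And>l. l < 5 \<Longrightarrow> (\<Sum>r<5. u r l) = 1" "\<And>l. l < 5 \<Longrightarrow> (\<Sum>r<5. v r l) = 1"
    and diag: "\<And>r. r < 5 \<Longrightarrow> u r r = 0" "\<And>r. r < 5 \<Longrightarrow> v r r = 0"
    and disj: "\<And>r l. r < 5 \<Longrightarrow> l < 5 \<Longrightarrow> u r l = 0 \<or> v r l = 0"
    and quad: "\<And>r s l. \<lbrakk>r < 5; s < 5; r \<noteq> s; l < 5; u r l \<noteq> 0; u s l \<noteq> 0\<rbrakk>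
                 \<Longrightarrow> \<exists>l'<5. l' \<noteq> l \<and> u r l' \<noteq> 0 \<and> u s l' \<noteq> 0"
    and lt: "j < 5" "a < 5" "b < 5" "c < 5"
    and abc: "a \<noteq> b" "a \<noteq> c" "b \<noteq> c"
    and nz: "u j a \<noteq> 0" "u j b \<noteq> 0" "u j c \<noteq> 0"
  shows False
proof -
  have ne: "j \<noteq> a" "j \<noteq> b" "j \<noteq> c"
    using diag(1) lt nz by auto
  have "card {j, a, b, c} = 4"
    using ne abc by simp
  then have "card ({..<5} - {j, a, b, c}) = 1"
    using lt by (subst card_Diff_subset) auto
  then obtain m where m: "{..<5} - {j, a, b, c} = {m}"
    by (auto simp: card_1_singleton_iff)
  then have I: "{..<5} = {j, m, a, b, c}" and mne: "m \<noteq> j" "m \<noteq> a" "m \<noteq> b" "m \<noteq> c"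
    using lt by auto
  have mlt: "m < 5"
    using m by auto
  have I2: "{..<5} = {j, m, b, a, c}" and I3: "{..<5} = {j, m, c, a, b}"
    using I by auto
  have a0: "u a b = 0 \<and> u a c = 0"
    by (rule unitary_pattern_aux[OF I _ nonneg rows cols diag disj quad]) (use ne abc mne nz in auto)
  have b0: "u b a = 0 \<and> u b c = 0"
    by (rule unitary_pattern_aux[OF I2 _ nonneg rows cols diag disj quad]) (use ne abc mne nz in auto)
  have c0: "u c a = 0 \<and> u c b = 0"
    by (rule unitary_pattern_aux[OF I3 _ nonneg rows cols diag disj quad]) (use ne abc mne nz in auto)
  have sum5: "(\<Sum>l<5. f l) = f j + f m + f a + f b + f c" for f :: "nat \<Rightarrow> real"
    unfolding I using ne abc mne by (simp add: add.assoc)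
  note ru = rows(1)[unfolded sum5] and cu = cols(1)[unfolded sum5]
  show False
    using ru[of a] ru[of b] ru[of c] cu[of j] cu[of m] a0 b0 c0 diag(1)[of a] diag(1)[of b] diag(1)[of c]
      lt mlt nonneg(1)[of j j] nonneg(1)[of j m] nonneg(1)[of m j] nonneg(1)[of m m]
    by linarith
qed

section \<open>Gram matrices of quantum Latin squares\<close>

definition cells :: "(nat \<times> nat) set" where
  "cells = {..<5} \<times> {..<5}"

definition grid_row :: "nat \<Rightarrow> (nat \<times> nat) set" where
  "grid_row r = {r} \<times> {..<5}"

definition grid_col :: "nat \<Rightarrow> (nat \<times> nat) set" where
  "grid_col l = {..<5} \<times> {l}"

text \<open>Rows and columns form one family because most arguments use only that the entries along
  such a line are an orthonormal basis.\<close>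

definition grid_lines :: "(nat \<times> nat) set set" where
  "grid_lines = grid_row ` {..<5} \<union> grid_col ` {..<5}"

section \<open>Incidence of cells with rows and columns\<close>

lemma finite_cells [simp]: "finite cells"
  by (simp add: cells_def)

lemma finite_grid_line [simp]: "L \<in> grid_lines \<Longrightarrow> finite L"
  by (auto simp: grid_lines_def grid_row_def grid_col_def)

lemma grid_line_subset: "L \<in> grid_lines \<Longrightarrow> L \<subseteq> cells"
  by (auto simp: grid_lines_def grid_row_def grid_col_def cells_def)

lemma grid_row_line [simp]: "r < 5 \<Longrightarrow> grid_row r \<in> grid_lines"
  and grid_col_line [simp]: "l < 5 \<Longrightarrow> grid_col l \<in> grid_lines"
  by (auto simp: grid_lines_def)

lemma mem_grid_row [simp]: "(r', l) \<in> grid_row r \<longleftrightarrow> r' = r \<and> l < 5"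
  and mem_grid_col [simp]: "(r, l') \<in> grid_col l \<longleftrightarrow> r < 5 \<and> l' = l"
  and mem_cells [simp]: "(r, l) \<in> cells \<longleftrightarrow> r < 5 \<and> l < 5"
  by (auto simp: grid_row_def grid_col_def cells_def)

lemma sum_grid_row: "(\<Sum>e\<in>grid_row r. f e) = (\<Sum>l<5. f (r, l))"
  unfolding grid_row_def
  by (rule sum.reindex_bij_witness[of _ "Pair r" snd]) auto

lemma sum_grid_col: "(\<Sum>e\<in>grid_col l. f e) = (\<Sum>r<5. f (r, l))"
  unfolding grid_col_def
  by (rule sum.reindex_bij_witness[of _ "\<lambda>r. (r, l)" fst]) auto

lemma swap_grid_line: "L \<in> grid_lines \<Longrightarrow> prod.swap ` L \<in> grid_lines"
proof -
  have "prod.swap ` grid_row r = grid_col r" "prod.swap ` grid_col r = grid_row r" for r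
    by (force simp: grid_row_def grid_col_def)+
  then show "L \<in> grid_lines \<Longrightarrow> prod.swap ` L \<in> grid_lines"
    by (auto simp: grid_lines_def)
qed

lemma swap_cells: "c \<in> cells \<Longrightarrow> prod.swap c \<in> cells"
  by (auto simp: cells_def)

text \<open>An abstraction of the matrix of inner products between entries of one square.
  \<open>parseval\<close> expands along the basis formed by a row or column, so the combinatorial
  part can be done without vectors.\<close>

locale qls_gram =
  fixes G :: "nat \<times> nat \<Rightarrow> nat \<times> nat \<Rightarrow> complex"
  assumes herm: "G d c = cnj (G c d)"
    and parseval: "\<lbrakk>L \<in> grid_lines; c \<in> cells; d \<in> cells\<rbrakk> \<Longrightarrow> G c d = (\<Sum>e\<in>L. G c e * G e d)"
    and ortho: "\<lbrakk>L \<in> grid_lines; c \<in> L; d \<in> L\<rbrakk> \<Longrightarrow> G c d = (if c = d then 1 else 0)"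
begin

text \<open>For unit vectors this is 0 exactly at orthogonal pairs and, by Cauchy-Schwarz, 1 exactly
  at parallel pairs.\<close>

definition w :: "nat \<times> nat \<Rightarrow> nat \<times> nat \<Rightarrow> real" where
  "w c d = (cmod (G c d))\<^sup>2"

lemma w_nonneg [simp]: "0 \<le> w c d"
  by (simp add: w_def)

lemma w_eq_0 [simp]: "w c d = 0 \<longleftrightarrow> G c d = 0"
  by (simp add: w_def)

lemma w_commute: "w c d = w d c"
  by (metis herm complex_mod_cnj w_def)

lemma zero_commute: "G c d = 0 \<longleftrightarrow> G d c = 0"
  by (metis herm complex_cnj_zero_iff)

lemma diag_1: "c \<in> cells \<Longrightarrow> G c c = 1"
  using ortho[of "grid_row (fst c)" c c] by (cases c) simp

lemma w_self: "c \<in> cells \<Longrightarrow> w c c = 1"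
  by (simp add: w_def diag_1)

lemma sum_w: assumes "L \<in> grid_lines" "c \<in> cells" shows "(\<Sum>e\<in>L. w c e) = 1"
proof -
  have "complex_of_real (\<Sum>e\<in>L. w c e) = (\<Sum>e\<in>L. G c e * G e c)"
    by (simp add: w_def herm[of _ c] complex_norm_square del: of_real_power)
  also have "\<dots> = 1"
    using parseval[OF assms assms(2)] diag_1[OF assms(2)] by simp
  finally show ?thesis
    using of_real_eq_1_iff by blast
qed

lemma sum_w_support:
  assumes "L \<in> grid_lines" "c \<in> cells" "S \<subseteq> L" "\<And>e. e \<in> L - S \<Longrightarrow> G c e = 0"
  shows "(\<Sum>e\<in>S. w c e) = 1"
  using sum.mono_neutral_left[of L S "w c"] sum_w[of L c] assms by auto

lemma parseval_support:
  assumes "L \<in> grid_lines" "c \<in> cells" "d \<in> cells" "S \<subseteq> L"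
    and "\<And>e. e \<in> L - S \<Longrightarrow> G c e = 0 \<or> G d e = 0"
  shows "G c d = (\<Sum>e\<in>S. G c e * G e d)"
proof -
  have "(\<Sum>e\<in>S. G c e * G e d) = (\<Sum>e\<in>L. G c e * G e d)"
    using assms zero_commute[of d] by (intro sum.mono_neutral_left) auto
  then show ?thesis
    using parseval[of L c d] assms by simp
qed

lemma shared_support:
  assumes "L \<in> grid_lines" "c \<in> cells" "d \<in> cells" "G c d \<noteq> 0"
  shows "\<exists>e\<in>L. G c e \<noteq> 0 \<and> G d e \<noteq> 0"
  using parseval_support[of L c d "{}"] assms by auto

text \<open>A Parseval sum with value 0 cannot have exactly one nonzero term.\<close>

lemma quadrangle:
  assumes "L \<in> grid_lines" "c \<in> cells" "d \<in> cells" "G c d = 0"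
    and "e \<in> L" "G c e \<noteq> 0" "G d e \<noteq> 0"
  shows "\<exists>e'\<in>L. e' \<noteq> e \<and> G c e' \<noteq> 0 \<and> G d e' \<noteq> 0"
  using parseval_support[of L c d "{e}"] assms zero_commute[of d e] by auto

lemma gram_swap: "qls_gram (\<lambda>c d. G (prod.swap c) (prod.swap d))"
proof
  fix L :: "(nat \<times> nat) set" and c d :: "nat \<times> nat"
  show "G (prod.swap d) (prod.swap c) = cnj (G (prod.swap c) (prod.swap d))"
    by (rule herm)
  show "G (prod.swap c) (prod.swap d) = (\<Sum>e\<in>L. G (prod.swap c) (prod.swap e) * G (prod.swap e) (prod.swap d))"
    if "L \<in> grid_lines" "c \<in> cells" "d \<in> cells"
    using that swap_grid_line swap_cells
    by (subst parseval[of "prod.swap ` L"]) (auto simp: sum.reindex)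
  show "G (prod.swap c) (prod.swap d) = (if c = d then 1 else 0)"
    if "L \<in> grid_lines" "c \<in> L" "d \<in> L"
    using ortho[of "prod.swap ` L" "prod.swap c" "prod.swap d"] that swap_grid_line
    by (auto simp: inj_eq)
qed

end

text \<open>An inner product of two product tensors is the product of the inner products of their
  factors; \<open>disj\<close> says that this product vanishes for distinct cells.\<close>

locale orthogonal_grams = g: qls_gram G + h: qls_gram H for G H +
  assumes disj: "\<lbrakk>c \<in> cells; d \<in> cells; c \<noteq> d\<rbrakk> \<Longrightarrow> G c d = 0 \<or> H c d = 0"
begin

text \<open>The squared moduli between row \<open>i\<close> of the cell \<open>c\<close> and row
  \<open>k\<close> satisfy the hypotheses of \<open>unitary_pattern_row_le_2\<close>: orthogonality
  within columns gives the zero diagonals, and \<open>disj\<close> the disjoint supports.\<close>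

lemma row_support_le_2:
  assumes "c \<in> cells" "k < 5" "e1 \<in> grid_row k" "e2 \<in> grid_row k" "e3 \<in> grid_row k"
    and ne: "e1 \<noteq> e2" "e1 \<noteq> e3" "e2 \<noteq> e3"
    and nz: "G c e1 \<noteq> 0" "G c e2 \<noteq> 0" "G c e3 \<noteq> 0"
  shows False
proof -
  obtain i j where c: "c = (i, j)" "i < 5" "j < 5"
    using assms(1) by (auto simp: cells_def)
  obtain l1 l2 l3 where e: "e1 = (k, l1)" "e2 = (k, l2)" "e3 = (k, l3)" "l1 < 5" "l2 < 5" "l3 < 5"
    using assms by (auto simp: grid_row_def)
  have ik: "i \<noteq> k"
    using nz ne g.ortho[of "grid_row k" c e1] g.ortho[of "grid_row k" c e2] c e assms(2)
    by (auto split: if_splits)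
  have cell: "(r, l) \<in> cells" if "r < 5" "l < 5" for r l
    using that by (simp add: cells_def)
  have in_row: "(r, l) \<in> grid_row r" and in_col: "(r, l) \<in> grid_col l" if "r < 5" "l < 5" for r l
    using that by (auto simp: grid_row_def grid_col_def)
  show False
  proof (rule unitary_pattern_row_le_2[where u = "\<lambda>r l. g.w (i, r) (k, l)"
        and v = "\<lambda>r l. h.w (i, r) (k, l)" and j = j and a = l1 and b = l2 and c = l3])
    fix r :: nat assume r: "r < 5"
    show "(\<Sum>l<5. g.w (i, r) (k, l)) = 1" "(\<Sum>l<5. h.w (i, r) (k, l)) = 1"
      using g.sum_w[of "grid_row k" "(i, r)"] h.sum_w[of "grid_row k" "(i, r)"] c assms r
      by (simp_all add: sum_grid_row cells_def)
    show "(\<Sum>l<5. g.w (i, l) (k, r)) = 1" "(\<Sum>l<5. h.w (i, l) (k, r)) = 1"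
      using g.sum_w[of "grid_row i" "(k, r)"] h.sum_w[of "grid_row i" "(k, r)"] c assms r
      by (simp_all add: sum_grid_row cells_def g.w_commute[of "(k, r)"] h.w_commute[of "(k, r)"])
    show "g.w (i, r) (k, r) = 0" "h.w (i, r) (k, r) = 0"
      using g.ortho[of "grid_col r" "(i, r)" "(k, r)"] h.ortho[of "grid_col r" "(i, r)" "(k, r)"]
        c assms r ik in_col by auto
    show "g.w (i, r) (k, l) = 0 \<or> h.w (i, r) (k, l) = 0" if "l < 5" for l
      using disj[of "(i, r)" "(k, l)"] cell c r ik assms that by auto
    show "\<exists>l'<5. l' \<noteq> l \<and> g.w (i, r) (k, l') \<noteq> 0 \<and> g.w (i, s) (k, l') \<noteq> 0"
      if sl: "s < 5" "r \<noteq> s" "l < 5" "g.w (i, r) (k, l) \<noteq> 0" "g.w (i, s) (k, l) \<noteq> 0" for s l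
    proof -
      have "G (i, r) (i, s) = 0"
        using g.ortho[of "grid_row i" "(i, r)" "(i, s)"] c r sl in_row by auto
      then obtain e' where "e' \<in> grid_row k" "e' \<noteq> (k, l)" "G (i, r) e' \<noteq> 0" "G (i, s) e' \<noteq> 0"
        using g.quadrangle[of "grid_row k" "(i, r)" "(i, s)" "(k, l)"] sl c r assms(2) by auto
      then show ?thesis
        by (cases e') auto
    qed
  qed (use c e ne nz in auto)
qed

end

section \<open>Transposition of both squares and the support bound for columns\<close>

lemma orthogonal_grams_swap:
  assumes "orthogonal_grams G H"
  shows "orthogonal_grams (\<lambda>c d. G (prod.swap c) (prod.swap d)) (\<lambda>c d. H (prod.swap c) (prod.swap d))"
proof -
  interpret orthogonal_grams G H by fact
  interpret g': qls_gram "\<lambda>c d. G (prod.swap c) (prod.swap d)" by (rule g.gram_swap)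
  interpret h': qls_gram "\<lambda>c d. H (prod.swap c) (prod.swap d)" by (rule h.gram_swap)
  show ?thesis
  proof
    show "G (prod.swap c) (prod.swap d) = 0 \<or> H (prod.swap c) (prod.swap d) = 0"
      if "c \<in> cells" "d \<in> cells" "c \<noteq> d" for c d
      using disj[of "prod.swap c" "prod.swap d"] that swap_cells by (auto simp: inj_eq)
  qed
qed

context orthogonal_grams
begin

lemma line_support_le_2:
  assumes "c \<in> cells" "L \<in> grid_lines" "e1 \<in> L" "e2 \<in> L" "e3 \<in> L"
    and "e1 \<noteq> e2" "e1 \<noteq> e3" "e2 \<noteq> e3"
    and "G c e1 \<noteq> 0" "G c e2 \<noteq> 0" "G c e3 \<noteq> 0"
  shows False
proof -
  consider k where "k < 5" "L = grid_row k" | k where "k < 5" "L = grid_col k"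
    using assms(2) by (auto simp: grid_lines_def)
  then show False
  proof cases
    case 1
    then show False
      using row_support_le_2[of c k e1 e2 e3] assms by blast
  next
    case 2
    interpret s: orthogonal_grams "\<lambda>c d. G (prod.swap c) (prod.swap d)" "\<lambda>c d. H (prod.swap c) (prod.swap d)"
      by (rule orthogonal_grams_swap) unfold_locales
    show False
      by (rule s.row_support_le_2[of "prod.swap c" k "prod.swap e1" "prod.swap e2" "prod.swap e3"])
        (use assms 2 swap_cells in \<open>auto simp: inj_eq grid_row_def grid_col_def\<close>)
  qed
qed

end

section \<open>The plane of two oblique entries\<close>

context orthogonal_grams
begin

text \<open>The supports of \<open>x\<close> and \<open>y\<close> along \<open>L\<close> are nested,
  and the larger has at most two elements by \<open>line_support_le_2\<close>. A union of only one
  element would make \<open>x\<close> and \<open>y\<close> parallel. The two entries found therefore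
  span the plane of \<open>x\<close> and \<open>y\<close>.\<close>

lemma plane_line:
  assumes x: "x \<in> cells" and y: "y \<in> cells" and nz: "G x y \<noteq> 0" and n1: "g.w x y \<noteq> 1"
    and L: "L \<in> grid_lines"
  shows "\<exists>a b. a \<noteq> b \<and> {e \<in> L. G x e \<noteq> 0 \<or> G y e \<noteq> 0} = {a, b}"
proof -
  have cell: "e \<in> cells" if "e \<in> L" for e
    using that L grid_line_subset by blast
  obtain b where b: "b \<in> L" "G x b \<noteq> 0" "G y b \<noteq> 0"
    using g.shared_support[OF L x y nz] by blast
  have not_only_b: "\<exists>a\<in>L. a \<noteq> b \<and> (G x a \<noteq> 0 \<or> G y a \<noteq> 0)"
  proof (rule ccontr)
    assume "\<not> ?thesis"
    then have only: "G x e = 0" "G y e = 0" if "e \<in> L - {b}" for e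
      using that by auto
    have "g.w x b = 1" "g.w y b = 1"
      using g.sum_w_support[OF L x, of "{b}"] g.sum_w_support[OF L y, of "{b}"] only b by auto
    moreover have "G x y = G x b * G b y"
      using g.parseval_support[OF L x y, of "{b}"] only b by auto
    ultimately have "g.w x y = 1"
      using g.w_commute[of b y] by (simp add: g.w_def norm_mult power_mult_distrib)
    with n1 show False by simp
  qed
  \<comment> \<open>Nestedness of the supports: in the row of \<open>y\<close>, the vector
    \<open>x\<close> is a combination of \<open>y\<close> and one further entry \<open>y'\<close>.
    Then \<open>y'\<close> is not orthogonal to \<open>a\<close> and \<open>c\<close>, and since it
    is orthogonal to \<open>y\<close> it shares with \<open>y\<close> a further entry
    \<open>c'\<close>, giving three nonzero coefficients.\<close>
  have no_two: False
    if a: "a \<in> L" "G x a \<noteq> 0" "G y a = 0" and c: "c \<in> L" "G y c \<noteq> 0" "G x c = 0" for a c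
  proof -
    define K where "K = grid_row (fst y)"
    have K: "K \<in> grid_lines" "y \<in> K"
      using y by (cases y; simp add: K_def)+
    have "\<exists>y'\<in>K. y' \<noteq> y \<and> G x y' \<noteq> 0"
      using g.sum_w_support[OF K(1) x, of "{y}"] K n1 by auto
    then obtain y' where y': "y' \<in> K" "y' \<noteq> y" "G x y' \<noteq> 0" by blast
    have y'c: "y' \<in> cells"
      using y' K grid_line_subset by blast
    have yy': "G y y' = 0"
      using g.ortho[OF K(1)] K y' by auto
    have expand: "G z x = G z y * G y x + G z y' * G y' x" if "z \<in> cells" for z
      using g.parseval_support[OF K(1) that x, of "{y, y'}"] K y' nz
        line_support_le_2[OF x K(1) K(2) y'(1)] by auto
    have "G a x \<noteq> 0" "G a y = 0" "G c x = 0" "G c y \<noteq> 0" "G y x \<noteq> 0"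
      using a c nz g.zero_commute by blast+
    then have "G a y' \<noteq> 0" "G c y' \<noteq> 0"
      using expand[OF cell[OF a(1)]] expand[OF cell[OF c(1)]] by auto
    then have ay: "G y' a \<noteq> 0" "G y' c \<noteq> 0"
      using g.zero_commute by blast+
    then obtain c' where c': "c' \<in> L" "c' \<noteq> c" "G y c' \<noteq> 0" "G y' c' \<noteq> 0"
      using g.quadrangle[OF L y y'c yy' c(1)] c by blast
    show False
      using line_support_le_2[OF y'c L a(1) c(1) c'(1)] a c c' ay by auto
  qed
  \<comment> \<open>By nestedness, one of \<open>x\<close> and \<open>y\<close> already carries the
    union of both supports.\<close>
  obtain z where z: "z \<in> cells" "\<And>e. e \<in> L \<Longrightarrow> (G x e \<noteq> 0 \<or> G y e \<noteq> 0) \<longleftrightarrow> G z e \<noteq> 0"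
  proof (cases "\<exists>a\<in>L. G x a \<noteq> 0 \<and> G y a = 0")
    case True
    then show ?thesis
      using no_two that[of x] x by blast
  next
    case False
    then show ?thesis
      using that[of y] y by blast
  qed
  obtain a where a: "a \<in> L" "a \<noteq> b" "G x a \<noteq> 0 \<or> G y a \<noteq> 0"
    using not_only_b by blast
  have "{e \<in> L. G x e \<noteq> 0 \<or> G y e \<noteq> 0} = {a, b}"
    using line_support_le_2[OF z(1) L a(1) b(1)] a b z(2) by blast
  with a(2) show ?thesis by blast
qed

text \<open>Pairs not orthogonal in \<open>G\<close> are orthogonal in \<open>H\<close>. So each of
  two cells in one row of the 2x2 block has \<open>H\<close>-mass at least 2 on the three cells of
  the 3x3 block outside \<open>N2\<close>, whereas Bessel at these three cells bounds the joint mass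
  by 3.\<close>

lemma no_two_three_blocks:
  assumes A: "A \<subseteq> {..<5}" "card A = 2" and B: "B \<subseteq> {..<5}" "card B = 2"
    and AB: "A \<times> B \<subseteq> N1"
    and N2: "N2 \<subseteq> ({..<5} - A) \<times> ({..<5} - B)" "card N2 = 6"
    and cross: "\<And>e f. e \<in> N1 \<Longrightarrow> f \<in> N2 \<Longrightarrow> G e f \<noteq> 0"
  shows False
proof -
  define A' B' where "A' = {..<5} - A" and "B' = {..<5} - B"
  define D where "D = A' \<times> B' - N2"
  have fin: "finite A" "finite B" "finite A'" "finite B'"
    using A B finite_subset by (auto simp: A'_def B'_def)
  have card': "card A' = 3" "card B' = 3"
    using A B fin by (simp_all add: A'_def B'_def card_Diff_subset)
  have "card D = 3"
    unfolding D_def using N2 card' finite_subset[OF N2(1)]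
    by (subst card_Diff_subset) (auto simp: A'_def B'_def card_cartesian_product)
  obtain a where a: "a \<in> A"
    using A by fastforce
  obtain b b' where b: "B = {b, b'}" "b \<noteq> b'"
    using B by (auto simp: card_2_iff)
  have lt: "a < 5" "b < 5" "b' < 5"
    using a b A B by auto
  \<comment> \<open>The rows in \<open>A'\<close> give \<open>(a, p)\<close> total mass 3. Column
    \<open>p\<close> contributes 0, column \<open>q\<close> at most 1, and \<open>N2\<close> nothing
    by \<open>cross\<close> and \<open>disj\<close>; the rest lies on \<open>D\<close>.\<close>
  have large: "2 \<le> (\<Sum>f\<in>D. h.w (a, p) f)" if pq: "B = {p, q}" "p \<noteq> q" for p q
  proof -
    have p: "p < 5" "q < 5" "(a, p) \<in> N1"
      using pq B AB a by auto
    have "(\<Sum>r\<in>A'. \<Sum>l<5. h.w (a, p) (r, l)) = (\<Sum>r\<in>A'. 1)"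
      using h.sum_w[of "grid_row _" "(a, p)"] lt p
      by (intro sum.cong) (auto simp: sum_grid_row A'_def)
    then have "3 = (\<Sum>r\<in>A'. \<Sum>l<5. h.w (a, p) (r, l))"
      using card' by simp
    also have "\<dots> = (\<Sum>r\<in>A'. (\<Sum>l\<in>B'. h.w (a, p) (r, l)) + (h.w (a, p) (r, p) + h.w (a, p) (r, q)))"
    proof (intro sum.cong refl)
      fix r
      have "{..<5} = B' \<union> {p, q}" "B' \<inter> {p, q} = {}"
        using B pq by (auto simp: B'_def)
      then show "(\<Sum>l<5. h.w (a, p) (r, l)) = (\<Sum>l\<in>B'. h.w (a, p) (r, l)) + (h.w (a, p) (r, p) + h.w (a, p) (r, q))"
        using pq fin by (simp add: sum.union_disjoint)
    qed
    also have "\<dots> = (\<Sum>f\<in>A' \<times> B'. h.w (a, p) f) + (\<Sum>r\<in>A'. h.w (a, p) (r, p)) + (\<Sum>r\<in>A'. h.w (a, p) (r, q))"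
      using fin by (simp add: sum.distrib sum.cartesian_product)
    also have "(\<Sum>r\<in>A'. h.w (a, p) (r, p)) = 0"
    proof (intro sum.neutral ballI)
      fix r assume "r \<in> A'"
      then show "h.w (a, p) (r, p) = 0"
        using h.ortho[of "grid_col p" "(a, p)" "(r, p)"] lt p a by (auto simp: A'_def)
    qed
    also have "(\<Sum>r\<in>A'. h.w (a, p) (r, q)) \<le> (\<Sum>r<5. h.w (a, p) (r, q))"
      by (intro sum_mono2) (auto simp: A'_def)
    also have "(\<Sum>r<5. h.w (a, p) (r, q)) = 1"
      using h.sum_w[of "grid_col q" "(a, p)"] lt p by (simp add: sum_grid_col)
    also have "(\<Sum>f\<in>A' \<times> B'. h.w (a, p) f) = (\<Sum>f\<in>D. h.w (a, p) f)"
    proof (intro sum.mono_neutral_right ballI)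
      fix f assume f: "f \<in> A' \<times> B' - D"
      then have "f \<in> N2" by (auto simp: D_def)
      moreover have "f \<in> cells" "(a, p) \<noteq> f"
        using f a by (auto simp: A'_def B'_def)
      ultimately show "h.w (a, p) f = 0"
        using cross[OF p(3), of f] disj[of "(a, p)" f] lt p by auto
    qed (use fin in \<open>auto simp: D_def\<close>)
    finally show ?thesis by simp
  qed
  \<comment> \<open>Bessel for each \<open>f\<close> in \<open>D\<close> against two entries of row
    \<open>a\<close>.\<close>
  have "(\<Sum>f\<in>D. h.w (a, b) f + h.w (a, b') f) \<le> (\<Sum>f\<in>D. 1)"
  proof (rule sum_mono)
    fix f assume "f \<in> D"
    then have f: "f \<in> cells"
      by (auto simp: D_def A'_def B'_def)
    have "(\<Sum>e\<in>{(a, b), (a, b')}. h.w f e) \<le> (\<Sum>e\<in>grid_row a. h.w f e)"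
      using lt by (intro sum_mono2) auto
    also have "\<dots> = 1"
      using h.sum_w[of "grid_row a" f] f lt by simp
    finally show "h.w (a, b) f + h.w (a, b') f \<le> 1"
      using b(2) by (simp add: h.w_commute[of f])
  qed
  then show False
    using large[of b b'] large[of b' b] b \<open>card D = 3\<close> by (auto simp: sum.distrib)
qed

text \<open>Modulus 1 means parallel. Oblique \<open>x\<close> and \<open>y\<close> would split the
  entries in their plane into those parallel or orthogonal to \<open>x\<close> and the remaining
  ones; the two classes form a configuration excluded by \<open>no_two_three_blocks\<close>.\<close>

lemma gram_unimodular:
  assumes x: "x \<in> cells" and y: "y \<in> cells" and nz: "G x y \<noteq> 0"
  shows "g.w x y = 1"
proof (rule ccontr)
  assume n1: "g.w x y \<noteq> 1"
  \<comment> \<open>By \<open>plane_line\<close>, the entries not orthogonal to the plane of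
    \<open>x\<close> and \<open>y\<close> are exactly those lying in it. \<open>M1\<close> collects
    those aligned with \<open>x\<close>, that is, orthogonal or parallel to it.\<close>
  define M where "M = {e \<in> cells. G x e \<noteq> 0 \<or> G y e \<noteq> 0}"
  define M1 where "M1 = {e \<in> M. g.w x e = 0 \<or> g.w x e = 1}"
  define M2 where "M2 = M - M1"
  have pair: "\<exists>a b. a \<noteq> b \<and> M \<inter> L = {a, b} \<and> g.w x a + g.w x b = 1"
    if L: "L \<in> grid_lines" for L
  proof -
    obtain a b where ab: "a \<noteq> b" "{e \<in> L. G x e \<noteq> 0 \<or> G y e \<noteq> 0} = {a, b}"
      using plane_line[OF x y nz n1 L] by blast
    have "M \<inter> L = {a, b}"
      using ab(2) grid_line_subset[OF L] by (auto simp: M_def)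
    moreover have "g.w x a + g.w x b = 1"
      using g.sum_w_support[OF L x, of "{a, b}"] ab by auto
    ultimately show ?thesis using ab(1) by blast
  qed
  have mate: "\<exists>e'. e' \<noteq> e \<and> M \<inter> L = {e, e'} \<and> g.w x e + g.w x e' = 1"
    if L: "L \<in> grid_lines" and e: "e \<in> M" "e \<in> L" for L e
  proof -
    obtain a b where ab: "a \<noteq> b" "M \<inter> L = {a, b}" "g.w x a + g.w x b = 1"
      using pair[OF L] by blast
    have "e = a \<or> e = b"
      using e ab(2) by blast
    then show ?thesis
    proof
      assume "e = a"
      then show ?thesis using ab by (intro exI[of _ b]) auto
    next
      assume "e = b"
      then show ?thesis using ab by (intro exI[of _ a]) auto
    qed
  qed
  \<comment> \<open>The values of \<open>w x\<close> at the two plane entries add up to 1, so one of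
    them is 0 or 1 exactly if the other is.\<close>
  have line_type: "M \<inter> L \<subseteq> M1 \<or> M \<inter> L \<subseteq> M2" if L: "L \<in> grid_lines" for L
  proof -
    obtain a b where ab: "M \<inter> L = {a, b}" "g.w x a + g.w x b = 1"
      using pair[OF L] by blast
    then have "a \<in> M" "b \<in> M" by auto
    then show ?thesis
      using ab by (auto simp: M1_def M2_def simp del: g.w_eq_0)
  qed
  have card_line: "card (M \<inter> L) = 2" if "L \<in> grid_lines" for L
    using pair[OF that] by auto
  \<comment> \<open>If \<open>e\<close> is parallel to \<open>x\<close>, the claim is that
    \<open>f\<close> is not orthogonal to \<open>x\<close>. Otherwise the other plane entry
    \<open>e'\<close> in the row of \<open>e\<close> is parallel to \<open>x\<close>, and a nonzero
    coefficient of \<open>f\<close> at \<open>e\<close> has to be found.\<close>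
  have cross: "G e f \<noteq> 0" if e: "e \<in> M1" and f: "f \<in> M2" for e f
  proof -
    have cells: "e \<in> cells" "f \<in> cells"
      using e f by (auto simp: M1_def M2_def M_def)
    define L K where "L = grid_row (fst e)" and "K = grid_row (fst f)"
    have L: "L \<in> grid_lines" "e \<in> L" and K: "K \<in> grid_lines" "f \<in> K"
      using cells by (cases e; cases f; simp add: L_def K_def)+
    have xf: "G x f \<noteq> 0" "g.w x f \<noteq> 1"
      using f by (auto simp: M1_def M2_def)
    obtain e' where e': "e' \<noteq> e" "M \<inter> L = {e, e'}" "g.w x e + g.w x e' = 1"
      using mate[OF L(1) _ L(2)] e by (auto simp: M1_def)
    have e'L: "e' \<in> L" "e' \<in> M"
      using e' by auto
    have single: "G z p \<noteq> 0 \<longleftrightarrow> G z x \<noteq> 0" if z: "z \<in> cells" and p: "{p, q} = {e, e'}" "G x q = 0" for z p q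
    proof -
      have "G x s = 0" if "s \<in> L - {p}" for s
        using that p e' grid_line_subset[OF L(1)] by (auto simp: M_def doubleton_eq_iff)
      then have "G z x = G z p * G p x" "g.w x p = 1"
        using g.parseval_support[OF L(1) z x, of "{p}"] g.sum_w_support[OF L(1) x, of "{p}"] p L e'L
        by (auto simp: doubleton_eq_iff)
      moreover have "G p x \<noteq> 0"
        using \<open>g.w x p = 1\<close> g.w_commute[of p x] g.w_eq_0[of p x] by auto
      ultimately show ?thesis by simp
    qed
    have fx: "G f x \<noteq> 0"
      using xf g.zero_commute by blast
    show ?thesis
    proof (cases "G x e = 0")
      case False
      then have "g.w x e = 1" "g.w x e' = 0"
        using e e' by (auto simp: M1_def)
      then have "G f e \<noteq> 0"
        using single[of f e e'] cells fx by auto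
      then show ?thesis using g.zero_commute by blast
    next
      case True
      then have par: "G z e' \<noteq> 0 \<longleftrightarrow> G z x \<noteq> 0" if "z \<in> cells" for z
        using single[OF that, of e' e] by auto
      obtain f' where f': "f' \<noteq> f" "M \<inter> K = {f, f'}" "g.w x f + g.w x f' = 1"
        using mate[OF K(1) _ K(2)] f by (auto simp: M2_def)
      have f'K: "f' \<in> K" "f' \<in> cells"
        using f' by (auto simp: M_def)
      have "G x f' \<noteq> 0"
        using f'(3) xf by (metis add.right_neutral g.w_eq_0)
      then have f'x: "G f' x \<noteq> 0"
        using g.zero_commute by blast
      have "G f f' = 0"
        using g.ortho[OF K(1)] K f' f'K by auto
      \<comment> \<open>The orthogonal entries \<open>f\<close> and \<open>f'\<close> both meet
        \<open>e'\<close>, hence share a second entry \<open>s\<close> of \<open>L\<close>. As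
        \<open>y\<close> lies in their span, it is supported on \<open>e'\<close> and
        \<open>s\<close>; it is not parallel to \<open>e'\<close>, so \<open>s\<close> belongs to
        \<open>M\<close> and must be \<open>e\<close>.\<close>
      then obtain s where s: "s \<in> L" "s \<noteq> e'" "G f s \<noteq> 0" "G f' s \<noteq> 0"
        using g.quadrangle[OF L(1) cells(2) f'K(2) _ e'L(1)] par cells f'K fx f'x by blast
      have "G y p = 0" if p: "p \<in> L" "p \<noteq> e'" "p \<noteq> s" for p
      proof -
        have pc: "p \<in> cells"
          using p L grid_line_subset by blast
        have "G f p = 0"
          using line_support_le_2[OF cells(2) L(1) p(1) e'L(1) s(1)] p s par[OF cells(2)] fx by blast
        moreover have "G f' p = 0"
          using line_support_le_2[OF f'K(2) L(1) p(1) e'L(1) s(1)] p s par[OF f'K(2)] f'x by blast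
        moreover have "G y p = G y f * G f p + G y f' * G f' p"
        proof -
          have "G y q = 0" if "q \<in> K - {f, f'}" for q
            using that f'(2) grid_line_subset[OF K(1)] by (auto simp: M_def)
          then show ?thesis
            using g.parseval_support[OF K(1) y pc, of "{f, f'}"] K f'K f'(1) by auto
        qed
        ultimately show ?thesis by simp
      qed
      moreover have "\<exists>p\<in>L. p \<noteq> e' \<and> G y p \<noteq> 0"
      proof (rule ccontr)
        assume "\<not> ?thesis"
        then have only: "G y p = 0" if "p \<in> L - {e'}" for p
          using that by auto
        have "g.w x e' = 1"
          using e'(3) g.w_eq_0[THEN iffD2, OF True] by linarith
        moreover have "g.w y e' = 1"
          using g.sum_w_support[OF L(1) y, of "{e'}"] only e'L by auto
        moreover have "G x y = G x e' * G e' y"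
          using g.parseval_support[OF L(1) x y, of "{e'}"] only e'L by auto
        ultimately have "g.w x y = 1"
          using g.w_commute[of e' y] by (simp add: g.w_def norm_mult power_mult_distrib)
        with n1 show False by simp
      qed
      ultimately have "G y s \<noteq> 0" by blast
      then have "s \<in> M \<inter> L"
        using s(1) grid_line_subset[OF L(1)] by (auto simp: M_def)
      then have "s = e" using e'(2) s(2) by blast
      then show ?thesis using s(3) g.zero_commute by blast
    qed
  qed
  have Mcells: "M \<subseteq> cells" "M1 \<subseteq> M" "M2 \<subseteq> M" "M1 \<inter> M2 = {}" "M1 \<union> M2 = M"
    by (auto simp: M_def M1_def M2_def)
  have finM: "finite M"
    using finite_subset[OF Mcells(1)] by simp
  have row_of: "grid_row (fst e) \<in> grid_lines" "e \<in> grid_row (fst e)"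
      "grid_col (snd e) \<in> grid_lines" "e \<in> grid_col (snd e)" if "e \<in> M" for e
    using subsetD[OF Mcells(1) that] by (cases e; simp)+
  \<comment> \<open>By \<open>line_type\<close>, a row or column meeting one class has both its
    plane entries in that class.\<close>
  have block: "N \<inter> grid_row r = (if r \<in> fst ` N then M \<inter> grid_row r else {})"
      "N \<inter> grid_col r = (if r \<in> snd ` N then M \<inter> grid_col r else {})"
    if N: "N = M1 \<or> N = M2" for N r
  proof -
    have NM: "N \<subseteq> M"
      using N Mcells by blast
    have *: "N \<inter> L = M \<inter> L" if "L \<in> grid_lines" "e \<in> N" "e \<in> L" for L e
      using line_type[OF that(1)] that N NM Mcells(4) by blast
    show "N \<inter> grid_row r = (if r \<in> fst ` N then M \<inter> grid_row r else {})"
    proof (cases "r \<in> fst ` N")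
      case True
      then obtain e where "e \<in> N" "r = fst e" by blast
      then show ?thesis
        using *[of "grid_row r" e] row_of[of e] NM True by auto
    qed (force simp: grid_row_def)
    show "N \<inter> grid_col r = (if r \<in> snd ` N then M \<inter> grid_col r else {})"
    proof (cases "r \<in> snd ` N")
      case True
      then obtain e where "e \<in> N" "r = snd e" by blast
      then show ?thesis
        using *[of "grid_col r" e] row_of[of e] NM True by auto
    qed (force simp: grid_col_def)
  qed
  have card_block: "card N = 2 * card (fst ` N)" "card N = 2 * card (snd ` N)" if N: "N = M1 \<or> N = M2" for N
  proof -
    have NM: "N \<subseteq> M" "finite N"
      using N Mcells(2,3) finM finite_subset by blast+
    have "N = (\<Union>r\<in>fst ` N. M \<inter> grid_row r)"
    proof -
      have "N = (\<Union>r\<in>fst ` N. N \<inter> grid_row r)"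
        using row_of NM by blast
      also have "\<dots> = (\<Union>r\<in>fst ` N. M \<inter> grid_row r)"
        using block(1)[OF N] by simp
      finally show ?thesis .
    qed
    moreover have "card (\<Union>r\<in>fst ` N. M \<inter> grid_row r) = (\<Sum>r\<in>fst ` N. card (M \<inter> grid_row r))"
      using NM finM by (intro card_UN_disjoint) (auto simp: grid_row_def)
    moreover have "(\<Sum>r\<in>fst ` N. card (M \<inter> grid_row r)) = (\<Sum>r\<in>fst ` N. 2)"
      using NM row_of by (intro sum.cong) (auto intro!: card_line)
    ultimately show "card N = 2 * card (fst ` N)" by simp
    have "N = (\<Union>r\<in>snd ` N. M \<inter> grid_col r)"
    proof -
      have "N = (\<Union>r\<in>snd ` N. N \<inter> grid_col r)"
        using row_of NM by blast
      also have "\<dots> = (\<Union>r\<in>snd ` N. M \<inter> grid_col r)"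
        using block(2)[OF N] by simp
      finally show ?thesis .
    qed
    moreover have "card (\<Union>r\<in>snd ` N. M \<inter> grid_col r) = (\<Sum>r\<in>snd ` N. card (M \<inter> grid_col r))"
      using NM finM by (intro card_UN_disjoint) (auto simp: grid_col_def)
    moreover have "(\<Sum>r\<in>snd ` N. card (M \<inter> grid_col r)) = (\<Sum>r\<in>snd ` N. 2)"
      using NM row_of by (intro sum.cong) (auto intro!: card_line)
    ultimately show "card N = 2 * card (snd ` N)" by simp
  qed
  \<comment> \<open>The column of a cell of \<open>N\<close> holds two cells of \<open>N\<close>,
    necessarily in different rows.\<close>
  have rows_ge: "2 \<le> card (fst ` N)" if N: "N = M1 \<or> N = M2" and ne: "e \<in> N" for N e
  proof -
    have e: "e \<in> M" using N ne Mcells by auto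
    have "N \<inter> grid_col (snd e) = M \<inter> grid_col (snd e)"
      using block(2)[OF N] ne by auto
    then have 2: "card (N \<inter> grid_col (snd e)) = 2"
      using card_line row_of[OF e] by simp
    have "inj_on fst (N \<inter> grid_col (snd e))"
      by (auto simp: inj_on_def grid_col_def)
    then have "card (fst ` (N \<inter> grid_col (snd e))) = 2"
      using 2 by (simp add: card_image)
    moreover have "finite (fst ` N)"
      using N Mcells finM finite_subset by blast
    ultimately show ?thesis
      using card_mono[of "fst ` N" "fst ` (N \<inter> grid_col (snd e))"] by (simp add: image_mono)
  qed
  \<comment> \<open>Two rows give four cells in two columns, so \<open>N\<close> is a full 2x2
    block; three rows give six cells, all outside the rows and columns of \<open>N\<close>.\<close>
  have finish: False
    if N: "N = M1 \<and> N' = M2 \<or> N = M2 \<and> N' = M1" and card2: "card (fst ` N) = 2" and card3: "card (fst ` N') = 3" for N N'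
  proof -
    have N1: "N = M1 \<or> N = M2" and N2: "N' = M1 \<or> N' = M2" using N by auto
    have NM: "N \<subseteq> M" "N' \<subseteq> M" "N \<inter> N' = {}"
      using N Mcells by auto
    have c: "card (snd ` N) = 2" "card N' = 6" "card N = 4"
      using card_block[OF N1] card_block[OF N2] card2 card3 by auto
    have "N \<subseteq> fst ` N \<times> snd ` N"
      by force
    moreover have "card (fst ` N \<times> snd ` N) = card N"
      using card2 c by (simp add: card_cartesian_product)
    moreover have "finite (fst ` N \<times> snd ` N)"
      using NM finM finite_subset by blast
    ultimately have AB: "N = fst ` N \<times> snd ` N"
      using card_subset_eq by metis
    have disjr: "fst e \<notin> fst ` N" "snd e \<notin> snd ` N" if e: "e \<in> N'" for e
    proof -
      have eM: "e \<in> M" "e \<notin> N" using e NM by auto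
      show "fst e \<notin> fst ` N"
        using block(1)[OF N1, of "fst e"] eM row_of[OF eM(1)] by (auto split: if_splits)
      show "snd e \<notin> snd ` N"
        using block(2)[OF N1, of "snd e"] eM row_of[OF eM(1)] by (auto split: if_splits)
    qed
    have sub: "fst ` N \<subseteq> {..<5}" "snd ` N \<subseteq> {..<5}"
      using subset_trans[OF NM(1) Mcells(1)] by (auto simp: cells_def)
    have "N' \<subseteq> ({..<5} - fst ` N) \<times> ({..<5} - snd ` N)"
    proof
      fix e assume e: "e \<in> N'"
      then have "e \<in> cells" using NM Mcells by auto
      then show "e \<in> ({..<5} - fst ` N) \<times> ({..<5} - snd ` N)"
        using disjr[OF e] by (cases e) auto
    qed
    moreover have "G e f \<noteq> 0" if "e \<in> N" "f \<in> N'" for e f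
      using that N cross[of e f] cross[of f e] g.zero_commute[of e f] by auto
    ultimately show False
      using no_two_three_blocks[OF sub(1) card2 sub(2) c(1), of N N'] AB c(2) by auto
  qed
  \<comment> \<open>Both classes are nonempty, and their rows partition the five rows, so they
    occupy two and three rows in some order.\<close>
  have "x \<in> M1"
    using x g.diag_1[OF x] by (auto simp: M1_def M_def g.w_self)
  moreover have "y \<in> M2"
    using y nz n1 by (auto simp: M2_def M1_def M_def)
  ultimately have ge: "2 \<le> card (fst ` M1)" "2 \<le> card (fst ` M2)"
    using rows_ge by blast+
  have "fst ` M1 \<inter> fst ` M2 = {}"
  proof (rule ccontr)
    assume "\<not> ?thesis"
    then obtain r where r: "r \<in> fst ` M1" "r \<in> fst ` M2" by blast
    then have "M1 \<inter> grid_row r = M \<inter> grid_row r" "M2 \<inter> grid_row r = M \<inter> grid_row r"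
      using block(1)[of M1 r] block(1)[of M2 r] by auto
    moreover have "card (M \<inter> grid_row r) = 2"
      using r(1) Mcells(2) row_of(1) card_line by blast
    moreover have "M1 \<inter> grid_row r \<inter> (M2 \<inter> grid_row r) = {}"
      using Mcells(4) by blast
    ultimately show False
      by simp
  qed
  moreover have "fst ` M1 \<union> fst ` M2 = {..<5}"
  proof
    show "fst ` M1 \<union> fst ` M2 \<subseteq> {..<5}"
      using subset_trans[OF Mcells(2) Mcells(1)] subset_trans[OF Mcells(3) Mcells(1)]
      by (auto simp: cells_def)
    show "{..<5} \<subseteq> fst ` M1 \<union> fst ` M2"
    proof
      fix r :: nat assume "r \<in> {..<5}"
      then have "grid_row r \<in> grid_lines" by simp
      then obtain e where "e \<in> M" "e \<in> grid_row r" using pair by blast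
      then have "r \<in> fst ` M" by (force simp: grid_row_def)
      then show "r \<in> fst ` M1 \<union> fst ` M2"
        using Mcells(5) by (metis image_Un)
    qed
  qed
  moreover have "finite (fst ` M1)" "finite (fst ` M2)"
    using Mcells finM finite_subset by blast+
  ultimately have "card (fst ` M1) + card (fst ` M2) = 5"
    using card_Un_disjoint[of "fst ` M1" "fst ` M2"] by simp
  then have "card (fst ` M1) = 2 \<and> card (fst ` M2) = 3 \<or> card (fst ` M2) = 2 \<and> card (fst ` M1) = 3"
    using ge by linarith
  then show False
    using finish by blast
qed

end

section \<open>From Gram matrices to squares\<close>

text \<open>Taking inner products with \<open>F k\<close> identifies the coefficients whose
  existence \<open>is_onb\<close> asserts.\<close>

lemma onb_expansion:
  assumes onb: "is_onb I F J" and fin: "finite I" "finite J" and v: "v \<in> cvecs I"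
  shows "v a = (\<Sum>j\<in>J. cinner I (F j) v * F j a)"
proof -
  obtain c where c: "v = (\<lambda>x. \<Sum>j\<in>J. c j * F j x)"
    using onb v unfolding is_onb_def by blast
  have "cinner I (F k) v = c k" if k: "k \<in> J" for k
  proof -
    have "cinner I (F k) v = (\<Sum>x\<in>I. \<Sum>j\<in>J. c j * (cnj (F k x) * F j x))"
      unfolding cinner_def c by (simp add: sum_distrib_left mult.left_commute)
    also have "\<dots> = (\<Sum>j\<in>J. c j * cinner I (F k) (F j))"
      by (subst sum.swap) (simp add: cinner_def sum_distrib_left)
    also have "\<dots> = (\<Sum>j\<in>J. if j = k then c j else 0)"
      using onb k unfolding is_onb_def by (intro sum.cong) auto
    finally show ?thesis
      using k fin by simp
  qed
  then show ?thesis
    by (subst c) simp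
qed

lemma onb_parseval:
  assumes onb: "is_onb I F J" and fin: "finite I" "finite J" and v: "v \<in> cvecs I"
  shows "cinner I u v = (\<Sum>j\<in>J. cinner I u (F j) * cinner I (F j) v)"
proof -
  have "cinner I u v = (\<Sum>x\<in>I. \<Sum>j\<in>J. cinner I (F j) v * (cnj (u x) * F j x))"
    unfolding cinner_def[of I u v]
    by (subst onb_expansion[OF assms]) (simp add: sum_distrib_left mult.left_commute)
  also have "\<dots> = (\<Sum>j\<in>J. cinner I (F j) v * cinner I u (F j))"
    by (subst sum.swap) (simp add: cinner_def sum_distrib_left)
  finally show ?thesis
    by (simp add: mult.commute)
qed

section \<open>Tensor products and the Gram matrices of a pair of squares\<close>

lemma cinner_commute: "cinner I v u = cnj (cinner I u v)"
  by (simp add: cinner_def mult.commute)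

lemma cinner_tensor:
  "cinner (I \<times> J) (tensor u v) (tensor u' v') = cinner I u u' * cinner J v v'"
  by (simp add: cinner_def tensor_def sum_product sum.cartesian_product algebra_simps case_prod_beta)

lemma QLS_entry_cvecs:
  assumes "is_QLS n Psi" "i < n" "j < n"
  shows "Psi i j \<in> cvecs {..<n}"
  using assms unfolding is_QLS_def is_onb_def by auto

definition gram :: "square \<Rightarrow> nat \<times> nat \<Rightarrow> nat \<times> nat \<Rightarrow> complex" where
  "gram Psi c d = cinner {..<5} (Psi (fst c) (snd c)) (Psi (fst d) (snd d))"

lemma qls_gram_gram:
  assumes "is_QLS 5 Psi"
  shows "qls_gram (gram Psi)"
proof
  fix L :: "(nat \<times> nat) set" and c d :: "nat \<times> nat"
  have row: "is_onb {..<5} (\<lambda>j. Psi i j) {..<5}" and col: "is_onb {..<5} (\<lambda>j. Psi j i) {..<5}" if "i < 5" for i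
    using assms that by (auto simp: is_QLS_def)
  show "gram Psi d c = cnj (gram Psi c d)"
    unfolding gram_def by (rule cinner_commute)
  assume L: "L \<in> grid_lines"
  then consider k where "k < 5" "L = grid_row k" | k where "k < 5" "L = grid_col k"
    by (auto simp: grid_lines_def)
  note L_cases = this
  show "gram Psi c d = (\<Sum>e\<in>L. gram Psi c e * gram Psi e d)" if "c \<in> cells" "d \<in> cells"
  proof -
    have d: "Psi (fst d) (snd d) \<in> cvecs {..<5}"
      using QLS_entry_cvecs[OF assms] that by (auto simp: cells_def)
    show ?thesis
      using L_cases
    proof cases
      case 1
      then show ?thesis
        using onb_parseval[OF row[OF 1(1)] _ _ d, of "Psi (fst c) (snd c)"] by (simp add: gram_def sum_grid_row)
    next
      case 2
      then show ?thesis
        using onb_parseval[OF col[OF 2(1)] _ _ d, of "Psi (fst c) (snd c)"] by (simp add: gram_def sum_grid_col)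
    qed
  qed
  show "gram Psi c d = (if c = d then 1 else 0)" if "c \<in> L" "d \<in> L"
    using L_cases
  proof cases
    case 1
    then show ?thesis
      using row[OF 1(1)] that by (cases c; cases d) (auto simp: gram_def is_onb_def)
  next
    case 2
    then show ?thesis
      using col[OF 2(1)] that by (cases c; cases d) (auto simp: gram_def is_onb_def)
  qed
qed

lemma orthogonal_grams_gram:
  assumes "is_QLS 5 Psi" "is_QLS 5 Phi" "orthogonal_QLS 5 Psi Phi"
  shows "orthogonal_grams (gram Psi) (gram Phi)"
proof -
  interpret g: qls_gram "gram Psi" by (rule qls_gram_gram) fact
  interpret h: qls_gram "gram Phi" by (rule qls_gram_gram) fact
  show ?thesis
  proof
    fix c d assume "c \<in> cells" "d \<in> cells" "c \<noteq> d"
    moreover have "\<forall>c\<in>cells. \<forall>d\<in>cells.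
        cinner ({..<5} \<times> {..<5}) (tensor (Psi (fst c) (snd c)) (Phi (fst c) (snd c)))
          (tensor (Psi (fst d) (snd d)) (Phi (fst d) (snd d))) = (if c = d then 1 else 0)"
      using assms(3) unfolding orthogonal_QLS_def is_onb_def cells_def case_prod_beta by (elim conjE)
    ultimately have "cinner ({..<5} \<times> {..<5}) (tensor (Psi (fst c) (snd c)) (Phi (fst c) (snd c)))
        (tensor (Psi (fst d) (snd d)) (Phi (fst d) (snd d))) = 0"
      by simp
    then show "gram Psi c d = 0 \<or> gram Phi c d = 0"
      by (simp add: cinner_tensor gram_def)
  qed
qed

section \<open>Exchange of the two squares and passage to the standard basis\<close>

lemma orthogonal_grams_commute:
  assumes "orthogonal_grams G H" shows "orthogonal_grams H G"
proof -
  interpret orthogonal_grams G H by fact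
  show ?thesis
    by unfold_locales (use disj in blast)
qed

text \<open>The matrix sends a vector to its coordinates with respect to \<open>F\<close>.
  \<open>unitary_mat\<close> asks for orthonormal columns, which is the completeness relation
  obtained by expanding a standard basis vector in \<open>F\<close>.\<close>

lemma onb_adjoint_unitary:
  assumes "is_onb {..<n} F {..<n}"
  shows "unitary_mat n (\<lambda>a b. cnj (F a b))"
  unfolding unitary_mat_def
proof (intro allI impI)
  fix a b assume ab: "a < n" "b < n"
  have "std_basis b \<in> cvecs {..<n}"
    using ab by (auto simp: cvecs_def std_basis_def)
  moreover have "cinner {..<n} (F k) (std_basis b) = cnj (F k b)" for k
    using ab by (simp add: cinner_def std_basis_def if_distrib cong: if_cong)
  ultimately have "std_basis b a = (\<Sum>k<n. cnj (F k b) * F k a)"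
    using onb_expansion[OF assms, of "std_basis b" a] by simp
  then show "(\<Sum>k<n. cnj (cnj (F k a)) * cnj (F k b)) = (if a = b then 1 else 0)"
    by (simp add: std_basis_def mult.commute)
qed

text \<open>The image of an entry lists its inner products with row 0. One of them has modulus 1, so
  by Parseval the others vanish, and \<open>z\<close> cancels the remaining phase.\<close>

lemma adjoint_image_std_basis:
  assumes Psi: "is_QLS 5 Psi"
    and uni: "\<And>c d. c \<in> cells \<Longrightarrow> d \<in> cells \<Longrightarrow> gram Psi c d \<noteq> 0 \<Longrightarrow> cmod (gram Psi c d) = 1"
    and ij: "i < 5" "j < 5"
  shows "\<exists>z. cmod z = 1 \<and>
    (\<lambda>a. z * apply_mat 5 (\<lambda>a b. cnj (Psi 0 a b)) (Psi i j) a) \<in> std_basis ` {..<5}"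
proof -
  interpret qls_gram "gram Psi" by (rule qls_gram_gram) fact
  have ap: "apply_mat 5 (\<lambda>a b. cnj (Psi 0 a b)) (Psi i j) a = (if a < 5 then gram Psi (0, a) (i, j) else 0)" for a
    by (simp add: apply_mat_def gram_def cinner_def)
  obtain e where "e \<in> grid_row 0" "gram Psi (i, j) e \<noteq> 0"
    using shared_support[of "grid_row 0" "(i, j)" "(i, j)"] ij diag_1[of "(i, j)"] by auto
  then obtain k where k: "k < 5" "gram Psi (i, j) (0, k) \<noteq> 0"
    by (cases e) auto
  have k1: "w (i, j) (0, k) = 1"
    using uni[of "(i, j)" "(0, k)"] ij k by (simp add: w_def)
  have others: "gram Psi (0, a) (i, j) = 0" if "a < 5" "a \<noteq> k" for a
  proof -
    have "(\<Sum>e\<in>{(0, a), (0, k)}. w (i, j) e) \<le> (\<Sum>e\<in>grid_row 0. w (i, j) e)"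
      using that k by (intro sum_mono2) auto
    then have "w (i, j) (0, a) \<le> 0"
      using sum_w[of "grid_row 0" "(i, j)"] ij k1 that by simp
    then have "gram Psi (i, j) (0, a) = 0"
      using w_nonneg[of "(i, j)" "(0, a)"] w_eq_0 by (metis order_antisym)
    then show ?thesis
      using zero_commute by blast
  qed
  have nz: "gram Psi (0, k) (i, j) \<noteq> 0"
    using k zero_commute by blast
  define z where "z = inverse (gram Psi (0, k) (i, j))"
  have "cmod z = 1"
    using uni[of "(0, k)" "(i, j)"] nz k ij by (simp add: z_def norm_inverse)
  moreover have "(\<lambda>a. z * apply_mat 5 (\<lambda>a b. cnj (Psi 0 a b)) (Psi i j) a) = std_basis k"
    using others nz k by (auto simp: fun_eq_iff ap std_basis_def z_def)
  ultimately show ?thesis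
    using k by blast
qed

theorem mainTheorem4:
  fixes Psi Phi :: square
  assumes "is_QLS 5 Psi" and "is_QLS 5 Phi" and "orthogonal_QLS 5 Psi Phi"
  shows "classical_pair 5 Psi Phi"
proof -
  interpret gh: orthogonal_grams "gram Psi" "gram Phi"
    using assms by (rule orthogonal_grams_gram)
  interpret hg: orthogonal_grams "gram Phi" "gram Psi"
    by (rule orthogonal_grams_commute[OF gh.orthogonal_grams_axioms])
  \<comment> \<open>Coordinates with respect to the first row of each square; after this unitary
    step, one phase step with \<open>c\<close> and \<open>d\<close> reaches the standard
    basis.\<close>
  define U V where "U = (\<lambda>a b. cnj (Psi 0 a b))" and "V = (\<lambda>a b. cnj (Phi 0 a b))"
  have "cmod (gram Psi c d) = 1" if "c \<in> cells" "d \<in> cells" "gram Psi c d \<noteq> 0" for c d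
    using gh.gram_unimodular[OF that] norm_ge_zero[of "gram Psi c d"]
    by (auto simp: gh.g.w_def power2_eq_1_iff)
  then have "\<forall>i j. \<exists>z. i < 5 \<longrightarrow> j < 5 \<longrightarrow>
      cmod z = 1 \<and> (\<lambda>a. z * apply_mat 5 U (Psi i j) a) \<in> std_basis ` {..<5}"
    using adjoint_image_std_basis[OF assms(1)] unfolding U_def by meson
  then obtain c where c: "\<And>i j. i < 5 \<Longrightarrow> j < 5 \<Longrightarrow>
      cmod (c i j) = 1 \<and> (\<lambda>a. c i j * apply_mat 5 U (Psi i j) a) \<in> std_basis ` {..<5}"
    by metis
  have "cmod (gram Phi c d) = 1" if "c \<in> cells" "d \<in> cells" "gram Phi c d \<noteq> 0" for c d
    using hg.gram_unimodular[OF that] norm_ge_zero[of "gram Phi c d"]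
    by (auto simp: gh.h.w_def power2_eq_1_iff)
  then have "\<forall>i j. \<exists>z. i < 5 \<longrightarrow> j < 5 \<longrightarrow>
      cmod z = 1 \<and> (\<lambda>a. z * apply_mat 5 V (Phi i j) a) \<in> std_basis ` {..<5}"
    using adjoint_image_std_basis[OF assms(2)] unfolding V_def by meson
  then obtain d where d: "\<And>i j. i < 5 \<Longrightarrow> j < 5 \<Longrightarrow>
      cmod (d i j) = 1 \<and> (\<lambda>a. d i j * apply_mat 5 V (Phi i j) a) \<in> std_basis ` {..<5}"
    by metis
  have "unitary_mat 5 U" "unitary_mat 5 V"
    using assms unfolding U_def V_def is_QLS_def by (auto intro!: onb_adjoint_unitary)
  then have "isotopy_step 5 (Psi, Phi)
      (\<lambda>i j. apply_mat 5 U (Psi i j), \<lambda>i j. apply_mat 5 V (Phi i j))"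
    by (intro isotopy_step.unitary[where U = U and V = V]) auto
  moreover have "isotopy_step 5 (\<lambda>i j. apply_mat 5 U (Psi i j), \<lambda>i j. apply_mat 5 V (Phi i j))
      (\<lambda>i j a. c i j * apply_mat 5 U (Psi i j) a, \<lambda>i j a. d i j * apply_mat 5 V (Phi i j) a)"
    using c d by (intro isotopy_step.phase[where c = c and d = d]) auto
  ultimately have "isotopic 5 (Psi, Phi)
      (\<lambda>i j a. c i j * apply_mat 5 U (Psi i j) a, \<lambda>i j a. d i j * apply_mat 5 V (Phi i j) a)"
    unfolding isotopic_def by (meson rtranclp.rtrancl_into_rtrancl r_into_rtranclp)
  then show ?thesis
    unfolding classical_pair_def using c d by blast
qed

end
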